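(* Fix $\Join\,\in\{;,\parallel\}$. Let $\mathcal{X}$ and $\mathcal{Y}$ be elementary programs such that the empty partial string $\bot$ is not an element of $\mathcal{Y}$. Let $\ell_\mathcal{X} = \max\{|x| : x \in \mathcal{X}\}$ and $\ell_\mathcal{Y} = \min\{|y| : y \in \mathcal{Y}\}$, and let $n = \lfloor \ell_\mathcal{X}/\ell_\mathcal{Y} \rfloor$. Then $\mathcal{X}^{\Join} \subseteq \mathcal{Y}^{\Join}$ if and only if $\mathcal{X} \subseteq \bigcup_{k=0}^{n} \mathcal{Y}^{k\cdot\Join}$.
   Context: Fix a nonempty set $E$ of events and an alphabet $\Gamma$. A partial string is a triple $p = (E_p, \alpha_p, \preceq_p)$ with $E_p \subseteq E$, $\alpha_p \colon E_p \to \Gamma$ a labelling function and $\preceq_p$ a partial order on $E_p$. It is finite if $E_p$ is finite; $\mathsf{P}_f$ denotes the set of finite partial strings; the size $|p|$ is the cardinality of $E_p$; $\bot$ denotes the empty partial string ($E_\bot = \emptyset$). Partial strings $x,y$ are disjoint if $E_x\cap E_y=\emptyset$; partial strings are always assumed to be made disjoint by renaming events when composed. For disjoint $x,y$, the concurrent composition $x \parallel y$ and sequential composition $x ; y$ both have event set $E_x \cup E_y$ and labels inherited from $x$ and $y$; $e \preceq_{x\parallel y} e'$ iff $e \preceq_x e'$ or $e \preceq_y e'$; and $e \preceq_{x;y} e'$ iff ($e \in E_x$ and $e' \in E_y$) or $e \preceq_{x\parallel y} e'$. A monotonic bijective morphism $f\colon x \to y$ is a bijection $E_x \to E_y$ with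 $\alpha_x(e) = \alpha_y(f(e))$ for all $e$, and $e \preceq_x e' \Rightarrow f(e) \preceq_y f(e')$. Write $x \sqsubseteq y$ ($x$ refines $y$) if there is a monotonic bijective morphism from $y$ to $x$. For $\mathcal{X} \subseteq \mathsf{P}_f$ let ${\downarrow}\mathcal{X} = \{y \in \mathsf{P}_f : \exists x \in \mathcal{X},\ y \sqsubseteq x\}$. A program is a set $\mathcal{X} \subseteq \mathsf{P}_f$ with ${\downarrow}\mathcal{X} = \mathcal{X}$; the programs form a complete lattice under $\subseteq$. Put $1 = \{\bot\}$. For $\Join\,\in\{;,\parallel\}$ and programs $\mathcal{X},\mathcal{Y}$, $\mathcal{X} \Join \mathcal{Y} = {\downarrow}\{x \Join y : x \in \mathcal{X}, y \in \mathcal{Y}\}$. For a program $\mathcal{P}$, $\mathcal{P}^{\Join}$ is the least fixed point (w.r.t. $\subseteq$ on programs) of $\mathcal{Z} \mapsto 1 \cup (\mathcal{P} \Join \mathcal{Z})$; and $\mathcal{P}^{0\cdot\Join} = 1$, $\mathcal{P}^{(n+1)\cdot\Join} = \mathcal{P} \Join \mathcal{P}^{n\cdot\Join}$. A program $\mathcal{P}$ is elementary if $\mathcal{P} = {\downarrow}\mathcal{Q}$ for some finite nonempty set $\mathcal{Q}$ of finite partial strings. *)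

theory Defs
  imports Main "HOL-Library.FuncSet"
begin

record ('e, 'g) pstring =
  events :: "'e set"
  label :: "'e \<Rightarrow> 'g"
  prec :: "('e \<times> 'e) set"

text \<open>
  The labelling of \<open>p\<close> is a function with domain \<open>events p\<close>; it takes a fixed default value outside
  this domain, so that record equality is equality of partial strings and the empty partial string
  is unique.
\<close>

definition partial_string :: "('e, 'g) pstring \<Rightarrow> bool" where
  "partial_string p \<longleftrightarrow>
     label p \<in> extensional (events p) \<and> partial_order_on (events p) (prec p)"

definition fin_pstrings :: "('e, 'g) pstring set" where
  "fin_pstrings = {p. partial_string p \<and> finite (events p)}"

definition psize :: "('e, 'g) pstring \<Rightarrow> nat" where
  "psize p = card (events p)"

definition empty_pstring :: "('e, 'g) pstring" where
  "empty_pstring = \<lparr>events = {}, label = (\<lambda>_. undefined), prec = {}\<rparr>"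

definition disjoint_pstrings :: "('e, 'g) pstring \<Rightarrow> ('e, 'g) pstring \<Rightarrow> bool" where
  "disjoint_pstrings x y \<longleftrightarrow> events x \<inter> events y = {}"

text \<open>The two compositions are meaningful only for disjoint arguments.\<close>

definition par_comp :: "('e, 'g) pstring \<Rightarrow> ('e, 'g) pstring \<Rightarrow> ('e, 'g) pstring" where
  "par_comp x y =
     \<lparr>events = events x \<union> events y,
      label = (\<lambda>e \<in> events x \<union> events y. if e \<in> events x then label x e else label y e),
      prec = prec x \<union> prec y\<rparr>"

definition seq_comp :: "('e, 'g) pstring \<Rightarrow> ('e, 'g) pstring \<Rightarrow> ('e, 'g) pstring" where
  "seq_comp x y =
     \<lparr>events = events x \<union> events y,
      label = (\<lambda>e \<in> events x \<union> events y. if e \<in> events x then label x e else label y e),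
      prec = (events x \<times> events y) \<union> prec (par_comp x y)\<rparr>"

definition mono_bij_morphism ::
    "('e \<Rightarrow> 'e) \<Rightarrow> ('e, 'g) pstring \<Rightarrow> ('e, 'g) pstring \<Rightarrow> bool" where
  "mono_bij_morphism f x y \<longleftrightarrow>
     bij_betw f (events x) (events y) \<and>
     (\<forall>e \<in> events x. label x e = label y (f e)) \<and>
     (\<forall>e \<in> events x. \<forall>e' \<in> events x. (e, e') \<in> prec x \<longrightarrow> (f e, f e') \<in> prec y)"

definition refines :: "('e, 'g) pstring \<Rightarrow> ('e, 'g) pstring \<Rightarrow> bool" (infix "\<sqsubseteq>\<^sub>p" 50) where
  "x \<sqsubseteq>\<^sub>p y \<longleftrightarrow> (\<exists>f. mono_bij_morphism f y x)"

definition renaming :: "('e, 'g) pstring \<Rightarrow> ('e, 'g) pstring \<Rightarrow> bool" where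
  "renaming x x' \<longleftrightarrow>
     (\<exists>f. bij_betw f (events x) (events x') \<and>
          (\<forall>e \<in> events x. label x e = label x' (f e)) \<and>
          (\<forall>e \<in> events x. \<forall>e' \<in> events x. (e, e') \<in> prec x \<longleftrightarrow> (f e, f e') \<in> prec x'))"

definition down :: "('e, 'g) pstring set \<Rightarrow> ('e, 'g) pstring set" where
  "down X = {y \<in> fin_pstrings. \<exists>x \<in> X. y \<sqsubseteq>\<^sub>p x}"

lemma refines_refl: "x \<sqsubseteq>\<^sub>p x"
  unfolding refines_def mono_bij_morphism_def by (rule exI[of _ id]) auto

lemma refines_trans:
  assumes "x \<sqsubseteq>\<^sub>p y" and "y \<sqsubseteq>\<^sub>p z"
  shows "x \<sqsubseteq>\<^sub>p z"
proof -
  obtain f g where f: "mono_bij_morphism f y x" and g: "mono_bij_morphism g z y"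
    using assms unfolding refines_def by blast
  have "g e \<in> events y" if "e \<in> events z" for e
    using g that unfolding mono_bij_morphism_def bij_betw_def by blast
  then have "mono_bij_morphism (f \<circ> g) z x"
    using f g unfolding mono_bij_morphism_def by (auto intro: bij_betw_trans)
  then show ?thesis
    unfolding refines_def by blast
qed

lemma down_subset: "down X \<subseteq> fin_pstrings"
  unfolding down_def by blast

lemma down_down: "down (down X) = down X"
proof
  show "down (down X) \<subseteq> down X"
    unfolding down_def by (auto intro: refines_trans)
  show "down X \<subseteq> down (down X)"
  proof
    fix y
    assume y: "y \<in> down X"
    then have "y \<in> fin_pstrings"
      using down_subset by blast
    with y refines_refl[of y] show "y \<in> down (down X)"
      unfolding down_def[of "down X"] by blast
  qed
qed

lemma down_eq_iff:
  assumes "X \<subseteq> fin_pstrings"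
  shows "down X = X \<longleftrightarrow> (\<forall>x \<in> X. \<forall>y \<in> fin_pstrings. y \<sqsubseteq>\<^sub>p x \<longrightarrow> y \<in> X)"
proof -
  have "X \<subseteq> down X"
  proof
    fix x
    assume "x \<in> X"
    with assms refines_refl[of x] show "x \<in> down X"
      unfolding down_def by blast
  qed
  then have "down X = X \<longleftrightarrow> down X \<subseteq> X"
    by blast
  then show ?thesis
    unfolding down_def by blast
qed

lemma down_eqI:
  assumes "X \<subseteq> fin_pstrings"
    and "\<And>x y. x \<in> X \<Longrightarrow> y \<in> fin_pstrings \<Longrightarrow> y \<sqsubseteq>\<^sub>p x \<Longrightarrow> y \<in> X"
  shows "X \<subseteq> fin_pstrings \<and> down X = X"
  using assms by (auto simp: down_eq_iff[OF assms(1)])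

lemma down_eqD:
  assumes "down X = X" and "x \<in> X" and "y \<in> fin_pstrings" and "y \<sqsubseteq>\<^sub>p x"
  shows "y \<in> X"
  using assms unfolding down_def by blast

lemma empty_in_fin_pstrings: "empty_pstring \<in> fin_pstrings"
  by (simp add: fin_pstrings_def partial_string_def empty_pstring_def extensional_def
      partial_order_on_def preorder_on_def refl_on_def trans_def antisym_def)

lemma fin_pstring_no_events:
  assumes "p \<in> fin_pstrings" and "events p = {}"
  shows "p = empty_pstring"
proof -
  have "label p = (\<lambda>_. undefined)" "prec p = {}"
    using assms by (auto simp: fin_pstrings_def partial_string_def extensional_def
        partial_order_on_def preorder_on_def refl_on_def)
  with assms(2) show ?thesis
    by (simp add: empty_pstring_def)
qed

lemma down_empty_pstring: "down {empty_pstring} = {empty_pstring}"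
proof
  show "down {empty_pstring} \<subseteq> {empty_pstring}"
  proof
    fix p :: "('e, 'g) pstring"
    assume "p \<in> down {empty_pstring}"
    then have "p \<in> fin_pstrings" "events p = {}"
      by (auto simp: down_def refines_def mono_bij_morphism_def empty_pstring_def bij_betw_def)
    then show "p \<in> {empty_pstring}"
      using fin_pstring_no_events by blast
  qed
  show "{empty_pstring} \<subseteq> down {empty_pstring}"
    using empty_in_fin_pstrings by (simp add: down_def refines_refl)
qed

typedef ('e, 'g) program =
  "{X :: ('e, 'g) pstring set. X \<subseteq> fin_pstrings \<and> down X = X}"
  morphisms strings Program
  by (rule exI[of _ "{}"]) (simp add: down_def)

setup_lifting type_definition_program

instantiation program :: (type, type) complete_lattice
begin

lift_definition less_eq_program :: "('a, 'b) program \<Rightarrow> ('a, 'b) program \<Rightarrow> bool"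
  is "(\<subseteq>)" .

lift_definition less_program :: "('a, 'b) program \<Rightarrow> ('a, 'b) program \<Rightarrow> bool"
  is "(\<subset>)" .

lift_definition inf_program :: "('a, 'b) program \<Rightarrow> ('a, 'b) program \<Rightarrow> ('a, 'b) program"
  is "(\<inter>)" by (rule down_eqI) (auto dest: down_eqD)

lift_definition sup_program :: "('a, 'b) program \<Rightarrow> ('a, 'b) program \<Rightarrow> ('a, 'b) program"
  is "(\<union>)" by (rule down_eqI) (auto dest: down_eqD)

lift_definition bot_program :: "('a, 'b) program"
  is "{}" by (simp add: down_def)

lift_definition top_program :: "('a, 'b) program"
  is fin_pstrings by (rule down_eqI) blast+

lift_definition Inf_program :: "('a, 'b) program set \<Rightarrow> ('a, 'b) program"
  is "\<lambda>A. fin_pstrings \<inter> \<Inter>A" by (rule down_eqI) (auto dest: down_eqD)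

lift_definition Sup_program :: "('a, 'b) program set \<Rightarrow> ('a, 'b) program"
  is "\<lambda>A. \<Union>A" by (rule down_eqI) (auto dest: down_eqD)

instance
proof
  show "x < y \<longleftrightarrow> x \<le> y \<and> \<not> y \<le> x" for x y :: "('a, 'b) program"
    by transfer (rule less_le_not_le)
  show "x \<le> x" for x :: "('a, 'b) program"
    by transfer (rule order_refl)
  show "x \<le> z" if "x \<le> y" "y \<le> z" for x y z :: "('a, 'b) program"
    using that by transfer (rule order_trans)
  show "x = y" if "x \<le> y" "y \<le> x" for x y :: "('a, 'b) program"
    using that by transfer (rule antisym)
  show "inf x y \<le> x" "inf x y \<le> y" for x y :: "('a, 'b) program"
    by (transfer, simp)+
  show "x \<le> inf y z" if "x \<le> y" "x \<le> z" for x y z :: "('a, 'b) program"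
    using that by transfer simp
  show "x \<le> sup x y" "y \<le> sup x y" for x y :: "('a, 'b) program"
    by (transfer, simp)+
  show "sup y z \<le> x" if "y \<le> x" "z \<le> x" for x y z :: "('a, 'b) program"
    using that by transfer simp
  show "Inf A \<le> x" if "x \<in> A" for x and A :: "('a, 'b) program set"
    using that by (auto simp: less_eq_program.rep_eq Inf_program.rep_eq)
  show "z \<le> Inf A" if "\<And>x. x \<in> A \<Longrightarrow> z \<le> x" for z and A :: "('a, 'b) program set"
    using that strings[of z] by (auto simp: less_eq_program.rep_eq Inf_program.rep_eq)
  show "x \<le> Sup A" if "x \<in> A" for x and A :: "('a, 'b) program set"
    using that by (auto simp: less_eq_program.rep_eq Sup_program.rep_eq)
  show "Sup A \<le> z" if "\<And>x. x \<in> A \<Longrightarrow> x \<le> z" for z and A :: "('a, 'b) program set"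
    using that by (auto simp: less_eq_program.rep_eq Sup_program.rep_eq)
  show "Inf {} = (top :: ('a, 'b) program)"
    by transfer simp
  show "Sup {} = (bot :: ('a, 'b) program)"
    by transfer simp
qed

end

lift_definition one_program :: "('e, 'g) program"
  is "{empty_pstring}"
  using down_empty_pstring empty_in_fin_pstrings by blast

text \<open>
  \<open>J\<close> is \<^const>\<open>seq_comp\<close> or \<^const>\<open>par_comp\<close>. The arguments are made disjoint by renaming their
  events; pairs for which the event type is too small to allow this do not contribute.
\<close>

lift_definition prog_comp ::
    "(('e, 'g) pstring \<Rightarrow> ('e, 'g) pstring \<Rightarrow> ('e, 'g) pstring) \<Rightarrow>
     ('e, 'g) program \<Rightarrow> ('e, 'g) program \<Rightarrow> ('e, 'g) program"
  is "\<lambda>J X Y. down {J x' y' | x y x' y'. x \<in> X \<and> y \<in> Y \<and>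
        x' \<in> fin_pstrings \<and> y' \<in> fin_pstrings \<and>
        renaming x x' \<and> renaming y y' \<and> disjoint_pstrings x' y'}"
  using down_subset down_down by blast

definition prog_star ::
    "(('e, 'g) pstring \<Rightarrow> ('e, 'g) pstring \<Rightarrow> ('e, 'g) pstring) \<Rightarrow>
     ('e, 'g) program \<Rightarrow> ('e, 'g) program" where
  "prog_star J P = lfp (\<lambda>Z. sup one_program (prog_comp J P Z))"

lemma mono_star_step:
  fixes P :: "('e, 'g) program"
  shows "mono (\<lambda>Z. sup one_program (prog_comp J P Z))"
proof (rule monoI)
  fix Z Z' :: "('e, 'g) program"
  assume "Z \<le> Z'"
  then have "prog_comp J P Z \<le> prog_comp J P Z'"
    unfolding less_eq_program.rep_eq prog_comp.rep_eq down_def by blast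
  then show "sup one_program (prog_comp J P Z) \<le> sup one_program (prog_comp J P Z')"
    by (rule sup_mono[OF order_refl])
qed

lemma prog_star_unfold: "prog_star J P = sup one_program (prog_comp J P (prog_star J P))"
  unfolding prog_star_def by (rule lfp_unfold[OF mono_star_step])

primrec prog_pow ::
    "(('e, 'g) pstring \<Rightarrow> ('e, 'g) pstring \<Rightarrow> ('e, 'g) pstring) \<Rightarrow>
     ('e, 'g) program \<Rightarrow> nat \<Rightarrow> ('e, 'g) program" where
  "prog_pow J P 0 = one_program"
| "prog_pow J P (Suc n) = prog_comp J P (prog_pow J P n)"

definition elementary :: "('e, 'g) program \<Rightarrow> bool" where
  "elementary P \<longleftrightarrow>
     (\<exists>Q. finite Q \<and> Q \<noteq> {} \<and> Q \<subseteq> fin_pstrings \<and> strings P = down Q)"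

end

theory Submission
  imports Defs
begin

text \<open>
  The star of \<open>Y\<close> is the union of the powers of \<open>Y\<close>, and a string in the \<open>k\<close>-th power has at least
  \<open>k * l\<^sub>Y\<close> events with \<open>l\<^sub>Y > 0\<close>; so a string of size at most \<open>l\<^sub>X\<close> in the star already lies in a
  power with \<open>k \<le> l\<^sub>X div l\<^sub>Y\<close>. Conversely, lax associativity of the composition of programs makes
  the star of \<open>Y\<close> closed under composition from the left with every power of \<open>Y\<close>, hence with \<open>X\<close>.
\<close>

section \<open>Renaming, refinement and transport along injections\<close>

lemma renaming_refl: "renaming x x"
  unfolding renaming_def by (rule exI[of _ id]) auto

lemma renaming_imp_refines:
  assumes "renaming x x'"
  shows "x' \<sqsubseteq>\<^sub>p x"
  using assms unfolding renaming_def refines_def mono_bij_morphism_def by blast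

lemma psize_refines:
  assumes "x \<sqsubseteq>\<^sub>p y"
  shows "psize x = psize y"
  using assms bij_betw_same_card
  unfolding refines_def mono_bij_morphism_def psize_def by metis

lemma prec_subset:
  assumes "p \<in> fin_pstrings"
  shows "prec p \<subseteq> events p \<times> events p"
  using assms
  by (auto simp: fin_pstrings_def partial_string_def partial_order_on_def preorder_on_def
      refl_on_def)

lemma strings_subset: "strings P \<subseteq> fin_pstrings"
  using strings[of P] by simp

lemma strings_down_closed:
  assumes "x \<in> strings P" "y \<in> fin_pstrings" "y \<sqsubseteq>\<^sub>p x"
  shows "y \<in> strings P"
  using strings[of P] assms down_eqD by blast

text \<open>The copy of \<open>p\<close> on chosen new events, meaningful when \<open>f\<close> is
  injective on \<open>events p\<close>. Restricting the label to the image keeps it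
  extensional.\<close>

definition push :: "('e \<Rightarrow> 'e) \<Rightarrow> ('e, 'g) pstring \<Rightarrow> ('e, 'g) pstring" where
  "push f p =
     \<lparr>events = f ` events p,
      label = (\<lambda>e \<in> f ` events p. label p (inv_into (events p) f e)),
      prec = map_prod f f ` prec p\<rparr>"

lemma push_prec_iff:
  assumes "p \<in> fin_pstrings" "inj_on f (events p)" "a \<in> events p" "b \<in> events p"
  shows "(f a, f b) \<in> prec (push f p) \<longleftrightarrow> (a, b) \<in> prec p"
  using assms prec_subset[OF assms(1)] by (auto simp: push_def dest: inj_onD)

lemma push_in_fin_pstrings:
  assumes p: "p \<in> fin_pstrings" and f: "inj_on f (events p)"
  shows "push f p \<in> fin_pstrings"
proof -
  have po: "partial_order_on (events p) (prec p)" and fin: "finite (events p)"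
    using p by (auto simp: fin_pstrings_def partial_string_def)
  have tr: "trans (prec p)" and rf: "refl_on (events p) (prec p)" and an: "antisym (prec p)"
    using po by (auto simp: partial_order_on_def preorder_on_def)
  note sub = prec_subset[OF p]
  have "trans (prec (push f p))"
  proof (rule transI)
    fix a b c
    assume "(a, b) \<in> prec (push f p)" "(b, c) \<in> prec (push f p)"
    then obtain a' b' b'' c' where *: "(a', b') \<in> prec p" "(b'', c') \<in> prec p"
      "a = f a'" "b = f b'" "b = f b''" "c = f c'"
      by (auto simp: push_def)
    \<comment> \<open>The two pairs pick preimages of \<open>b\<close> independently; injectivity
      joins them into a chain in \<open>p\<close>.\<close>
    then have "b' = b''"
      using sub f by (auto dest: inj_onD)
    with * have "(a', c') \<in> prec p"
      using tr by (blast dest: transD)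
    with * show "(a, c) \<in> prec (push f p)"
      by (auto simp: push_def)
  qed
  moreover have "antisym (prec (push f p))"
  proof (rule antisymI)
    fix a b
    assume "(a, b) \<in> prec (push f p)" "(b, a) \<in> prec (push f p)"
    then obtain a' b' a'' b'' where *: "(a', b') \<in> prec p" "(b'', a'') \<in> prec p"
      "a = f a'" "b = f b'" "b = f b''" "a = f a''"
      by (auto simp: push_def)
    then have "b' = b''" "a' = a''"
      using sub f by (metis inj_onD mem_Sigma_iff subsetD)+
    with * show "a = b"
      using an by (blast dest: antisymD)
  qed
  moreover have "refl_on (events (push f p)) (prec (push f p))"
    using rf by (force simp: push_def refl_on_def)
  moreover have "prec (push f p) \<subseteq> events (push f p) \<times> events (push f p)"
    using sub by (auto simp: push_def)
  ultimately show ?thesis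
    using fin
    by (simp add: fin_pstrings_def partial_string_def partial_order_on_def preorder_on_def)
      (simp add: push_def)
qed

lemma renaming_push:
  assumes "p \<in> fin_pstrings" and "inj_on f (events p)"
  shows "renaming p (push f p)"
  unfolding renaming_def
proof (intro exI[of _ f] conjI ballI)
  show "bij_betw f (events p) (events (push f p))"
    using assms(2) by (simp add: push_def bij_betw_def)
  show "label p e = label (push f p) (f e)" if "e \<in> events p" for e
    using that assms(2) by (simp add: push_def)
  show "(e, e') \<in> prec p \<longleftrightarrow> (f e, f e') \<in> prec (push f p)"
    if "e \<in> events p" "e' \<in> events p" for e e'
    using push_prec_iff[OF assms that] by simp
qed

section \<open>Sequential and concurrent composition of partial strings\<close>

context
  fixes J :: "('e, 'g) pstring \<Rightarrow> ('e, 'g) pstring \<Rightarrow> ('e, 'g) pstring"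
  assumes J: "J \<in> {seq_comp, par_comp}"
begin

lemma comp_events: "events (J x y) = events x \<union> events y"
  using J by (auto simp: seq_comp_def par_comp_def)

lemma comp_label:
  "label (J x y) = (\<lambda>e \<in> events x \<union> events y. if e \<in> events x then label x e else label y e)"
  using J by (auto simp: seq_comp_def par_comp_def)

text \<open>Under either bracketing an event takes its label from the first argument containing it,
  and the cross blocks have the same union; so this is an equality of records, with no
  renaming.\<close>

lemma comp_assoc: "J (J x y) z = J x (J y z)"
  using J by (auto simp: seq_comp_def par_comp_def fun_eq_iff)

lemma comp_empty:
  assumes "x \<in> fin_pstrings"
  shows "J empty_pstring x = x" and "J x empty_pstring = x"
  using assms J
  by (auto simp: seq_comp_def par_comp_def empty_pstring_def fin_pstrings_def
      partial_string_def extensional_def fun_eq_iff intro!: pstring.equality)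

lemma comp_in_fin_pstrings:
  assumes "x \<in> fin_pstrings" "y \<in> fin_pstrings" "disjoint_pstrings x y"
  shows "J x y \<in> fin_pstrings"
proof -
  have po: "partial_order_on (events x) (prec x)" "partial_order_on (events y) (prec y)"
    using assms by (auto simp: fin_pstrings_def partial_string_def)
  note sub = prec_subset[OF assms(1)] prec_subset[OF assms(2)]
  have disj: "events x \<inter> events y = {}"
    using assms(3) by (simp add: disjoint_pstrings_def)
  \<comment> \<open>The two compositions differ only in the cross block. Disjointness leaves no pair
    from \<open>y\<close> back to \<open>x\<close>, so transitivity and antisymmetry survive in both
    cases.\<close>
  have pr: "prec (J x y) = prec x \<union> prec y \<or>
      prec (J x y) = events x \<times> events y \<union> (prec x \<union> prec y)"
    using J by (auto simp: seq_comp_def par_comp_def)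
  have tr: "trans (prec x)" "trans (prec y)" and an: "antisym (prec x)" "antisym (prec y)"
    using po by (auto simp: partial_order_on_def preorder_on_def)
  have "trans (prec (J x y))"
  proof (rule transI)
    fix a b c
    assume "(a, b) \<in> prec (J x y)" "(b, c) \<in> prec (J x y)"
    with pr show "(a, c) \<in> prec (J x y)"
      using sub disj tr[THEN transD, of a b c] by blast
  qed
  moreover have "antisym (prec (J x y))"
  proof (rule antisymI)
    fix a b
    assume "(a, b) \<in> prec (J x y)" "(b, a) \<in> prec (J x y)"
    with pr show "a = b"
      using sub disj an[THEN antisymD, of a b] by blast
  qed
  moreover have "refl_on (events (J x y)) (prec (J x y))"
    using J po
    by (auto simp: seq_comp_def par_comp_def partial_order_on_def preorder_on_def refl_on_def)
  moreover have "prec (J x y) \<subseteq> events (J x y) \<times> events (J x y)"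
    using J sub by (auto simp: seq_comp_def par_comp_def)
  ultimately show ?thesis
    using assms comp_events comp_label
    by (simp add: fin_pstrings_def partial_string_def partial_order_on_def preorder_on_def)
qed

text \<open>Absorbs the bijection \<open>h\<close> into the factors: their transported copies
  compose to a string on the very events of \<open>u\<close>, with an order contained in that of
  \<open>u\<close>. Whatever is disjoint from \<open>u\<close> is then disjoint from both
  copies.\<close>

lemma mono_bij_morphism_comp_push:
  assumes h: "mono_bij_morphism h (J y w) u" and "y \<in> fin_pstrings" "w \<in> fin_pstrings"
  shows "mono_bij_morphism id (J (push h y) (push h w)) u"
proof -
  have inj: "inj_on h (events y \<union> events w)" and img: "h ` (events y \<union> events w) = events u"
    using h by (auto simp: mono_bij_morphism_def bij_betw_def comp_events)
  have injs: "inj_on h (events y)" "inj_on h (events w)"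
    using inj by (auto intro: inj_on_subset)
  \<comment> \<open>Both composite labels branch on membership in the left factor; this makes them
    take the same branch.\<close>
  have mem: "h e \<in> h ` events y \<longleftrightarrow> e \<in> events y" if "e \<in> events y \<union> events w" for e
    using inj that by (auto dest: inj_onD)
  have ev: "events (push h y) = h ` events y" "events (push h w) = h ` events w"
    by (simp_all add: push_def)
  have lab: "label (J (push h y) (push h w)) (h e) = label u (h e)"
    if e: "e \<in> events y \<union> events w" for e
  proof -
    have "label (J y w) e = label u (h e)"
      using h e by (simp add: mono_bij_morphism_def comp_events)
    then show ?thesis
      using e mem[OF e] injs by (cases "e \<in> events y") (simp_all add: comp_label ev push_def)
  qed
  \<comment> \<open>A morphism is constrained only on events, so \<open>prec (J y w)\<close> must
    first be seen to relate events only.\<close>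
  have "(h a, h b) \<in> prec u" if "(a, b) \<in> prec (J y w)" for a b
  proof -
    have "a \<in> events (J y w)" "b \<in> events (J y w)"
      using that J prec_subset[OF assms(2)] prec_subset[OF assms(3)]
      by (auto simp: seq_comp_def par_comp_def)
    then show ?thesis
      using that h by (simp add: mono_bij_morphism_def)
  qed
  moreover have "prec (J (push h y) (push h w)) = map_prod h h ` prec (J y w)"
    using J by (auto simp: seq_comp_def par_comp_def push_def image_Un)
  ultimately have "prec (J (push h y) (push h w)) \<subseteq> prec u"
    by auto
  then show ?thesis
    using img lab by (auto simp: mono_bij_morphism_def comp_events ev bij_betw_def)
qed

lemma mono_bij_morphism_id_comp:
  assumes "mono_bij_morphism id v u" "v \<in> fin_pstrings"
  shows "mono_bij_morphism id (J v z) (J u z)"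
proof -
  have "events v = events u" "\<forall>e \<in> events u. label v e = label u e" "prec v \<subseteq> prec u"
    using assms(1) prec_subset[OF assms(2)] by (auto simp: mono_bij_morphism_def bij_betw_def)
  then show ?thesis
    using J by (auto simp: mono_bij_morphism_def bij_betw_def seq_comp_def par_comp_def)
qed

section \<open>Composition of programs\<close>

lemma prog_comp_stringsE:
  assumes "s \<in> strings (prog_comp J P R)"
  obtains x y x' y' where "x \<in> strings P" "y \<in> strings R" "x' \<in> fin_pstrings"
    "y' \<in> fin_pstrings" "renaming x x'" "renaming y y'" "disjoint_pstrings x' y'" "s \<sqsubseteq>\<^sub>p J x' y'"
  using assms unfolding prog_comp.rep_eq down_def by blast

lemma prog_comp_stringsI:
  assumes "s \<in> fin_pstrings" "x \<in> strings P" "y \<in> strings R" "disjoint_pstrings x y"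
    "s \<sqsubseteq>\<^sub>p J x y"
  shows "s \<in> strings (prog_comp J P R)"
  using assms strings_subset[of P] strings_subset[of R] renaming_refl
  unfolding prog_comp.rep_eq down_def by blast

text \<open>A renamed copy refines the original, so it already belongs to the down-closed program;
  the renamings can thus be dropped.\<close>

lemma prog_comp_stringsE':
  assumes "s \<in> strings (prog_comp J P R)"
  obtains x y where "x \<in> strings P" "y \<in> strings R" "disjoint_pstrings x y" "s \<sqsubseteq>\<^sub>p J x y"
  using assms by (meson prog_comp_stringsE strings_down_closed renaming_imp_refines)

lemma prog_comp_mono:
  assumes "P \<le> P'" "R \<le> R'"
  shows "prog_comp J P R \<le> prog_comp J P' R'"
  using assms unfolding less_eq_program.rep_eq prog_comp.rep_eq down_def by blast

text \<open>A composite draws a single string from the union, so one index suffices.\<close>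

lemma prog_comp_Sup_left: "prog_comp J (SUP i \<in> I. P i) R \<le> (SUP i \<in> I. prog_comp J (P i) R)"
  unfolding less_eq_program.rep_eq prog_comp.rep_eq down_def Sup_program.rep_eq image_image
  by blast

lemma prog_comp_Sup_right: "prog_comp J P (SUP i \<in> I. R i) \<le> (SUP i \<in> I. prog_comp J P (R i))"
  unfolding less_eq_program.rep_eq prog_comp.rep_eq down_def Sup_program.rep_eq image_image
  by blast

lemma prog_comp_one_left: "prog_comp J one_program R \<le> R"
  unfolding less_eq_program.rep_eq
proof
  fix s
  assume s: "s \<in> strings (prog_comp J one_program R)"
  then obtain x y where "x \<in> strings one_program" "y \<in> strings R" "s \<sqsubseteq>\<^sub>p J x y"
    by (rule prog_comp_stringsE')
  moreover from this have "J x y = y"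
    using comp_empty(1) strings_subset by (auto simp: one_program.rep_eq)
  ultimately show "s \<in> strings R"
    using s strings_subset strings_down_closed by (metis subsetD)
qed

lemma prog_comp_one_right: "P \<le> prog_comp J P one_program"
  unfolding less_eq_program.rep_eq
proof
  fix s
  assume s: "s \<in> strings P"
  then have "s \<in> fin_pstrings"
    using strings_subset by blast
  with s show "s \<in> strings (prog_comp J P one_program)"
    by (intro prog_comp_stringsI[of s s P empty_pstring])
      (auto simp: one_program.rep_eq disjoint_pstrings_def comp_empty refines_refl
        empty_pstring_def[THEN arg_cong[of _ _ events]])
qed

text \<open>
  The inner composition may be made disjoint in a way that clashes with the outer argument, so its
  two parts are transported along the morphism onto the actual left factor. No fresh events are
  needed, which is why this holds for finite event types as well.
\<close>

lemma prog_comp_assoc: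
  "prog_comp J (prog_comp J P Q) R \<le> prog_comp J P (prog_comp J Q R)"
  unfolding less_eq_program.rep_eq
proof
  fix s
  assume s: "s \<in> strings (prog_comp J (prog_comp J P Q) R)"
  then obtain u z where u: "u \<in> strings (prog_comp J P Q)" and z: "z \<in> strings R"
    and uz: "disjoint_pstrings u z" and s_le: "s \<sqsubseteq>\<^sub>p J u z"
    by (rule prog_comp_stringsE')
  from u obtain y w where y: "y \<in> strings P" and w: "w \<in> strings Q"
    and yw: "disjoint_pstrings y w" and u_le: "u \<sqsubseteq>\<^sub>p J y w"
    by (rule prog_comp_stringsE')
  from u_le obtain h where h: "mono_bij_morphism h (J y w) u"
    by (auto simp: refines_def)
  have fin: "y \<in> fin_pstrings" "w \<in> fin_pstrings" "z \<in> fin_pstrings" "s \<in> fin_pstrings"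
    using y w z s strings_subset by blast+
  have inj: "inj_on h (events y \<union> events w)" and img: "h ` (events y \<union> events w) = events u"
    using h by (auto simp: mono_bij_morphism_def bij_betw_def comp_events)
  have injs: "inj_on h (events y)" "inj_on h (events w)"
    using inj by (auto intro: inj_on_subset)
  let ?y = "push h y" and ?w = "push h w"
  have fin': "?y \<in> fin_pstrings" "?w \<in> fin_pstrings"
    using push_in_fin_pstrings fin injs by blast+
  have y': "?y \<in> strings P" and w': "?w \<in> strings Q"
    using strings_down_closed y w fin' fin injs renaming_push renaming_imp_refines by metis+
  have "h ` events y \<inter> h ` events w = {}"
    using inj yw by (auto simp: disjoint_pstrings_def dest: inj_onD)
  moreover have "(h ` events y \<union> h ` events w) \<inter> events z = {}"
    using img uz by (simp add: disjoint_pstrings_def image_Un)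
  ultimately have disj: "disjoint_pstrings ?y ?w" "disjoint_pstrings ?w z"
    "disjoint_pstrings ?y (J ?w z)"
    by (auto simp: disjoint_pstrings_def comp_events push_def)
  have "J u z \<sqsubseteq>\<^sub>p J (J ?y ?w) z"
    using mono_bij_morphism_id_comp[OF mono_bij_morphism_comp_push[OF h fin(1,2)]
        comp_in_fin_pstrings[OF fin' disj(1)]]
    by (auto simp: refines_def)
  with s_le have "s \<sqsubseteq>\<^sub>p J ?y (J ?w z)"
    using refines_trans by (metis comp_assoc)
  moreover have "J ?w z \<in> strings (prog_comp J Q R)"
    using prog_comp_stringsI[OF comp_in_fin_pstrings[OF fin'(2) fin(3) disj(2)] w' z disj(2)]
    by (simp add: refines_refl)
  ultimately show "s \<in> strings (prog_comp J P (prog_comp J Q R))"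
    using prog_comp_stringsI fin(4) y' disj(3) by blast
qed

section \<open>Star and powers\<close>

lemma one_le_prog_star: "one_program \<le> prog_star J P"
  by (subst prog_star_unfold) simp

lemma prog_comp_prog_star_le: "prog_comp J P (prog_star J P) \<le> prog_star J P"
  by (subst (2) prog_star_unfold) simp

lemma le_prog_star: "P \<le> prog_star J P"
  using prog_comp_one_right prog_comp_mono[OF order_refl one_le_prog_star] prog_comp_prog_star_le
  by (meson order_trans)

lemma prog_pow_le_prog_star: "prog_pow J P k \<le> prog_star J P"
proof (induction k)
  case 0
  show ?case
    by (simp add: one_le_prog_star)
next
  case (Suc k)
  then show ?case
    using prog_comp_mono[OF order_refl] prog_comp_prog_star_le by (fastforce intro: order_trans)
qed

text \<open>The union of the powers is a prefixed point of the star step: composing with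
  \<open>P\<close> distributes over the union and shifts the index by one.\<close>

lemma prog_star_le_Sup_prog_pow: "prog_star J P \<le> (SUP k. prog_pow J P k)"
  unfolding prog_star_def
proof (rule lfp_lowerbound, rule sup_least)
  show "one_program \<le> (SUP k. prog_pow J P k)"
    by (rule SUP_upper2[of 0]) simp_all
  have "prog_comp J P (SUP k. prog_pow J P k) \<le> (SUP k. prog_pow J P (Suc k))"
    using prog_comp_Sup_right by simp
  also have "\<dots> \<le> (SUP k. prog_pow J P k)"
    by (rule SUP_least) (rule SUP_upper, simp)
  finally show "prog_comp J P (SUP k. prog_pow J P k) \<le> (SUP k. prog_pow J P k)" .
qed

text \<open>Lax associativity detaches the outermost \<open>P\<close>; the induction hypothesis
  absorbs the remaining power into the star, which then absorbs \<open>P\<close>.\<close>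

lemma prog_pow_comp_prog_star: "prog_comp J (prog_pow J P k) (prog_star J P) \<le> prog_star J P"
proof (induction k)
  case 0
  show ?case
    by (simp add: prog_comp_one_left)
next
  case (Suc k)
  have "prog_comp J (prog_pow J P (Suc k)) (prog_star J P)
      \<le> prog_comp J P (prog_comp J (prog_pow J P k) (prog_star J P))"
    by (simp add: prog_comp_assoc)
  also have "\<dots> \<le> prog_comp J P (prog_star J P)"
    by (rule prog_comp_mono[OF order_refl Suc])
  also have "\<dots> \<le> prog_star J P"
    by (rule prog_comp_prog_star_le)
  finally show ?case .
qed

text \<open>The star of \<open>R\<close> is a prefixed point of the star step for \<open>P\<close>,
  since it absorbs each power of \<open>R\<close> from the left; the star of \<open>P\<close> is the
  least one.\<close>

lemma prog_star_le_if_le_Sup_prog_pow: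
  assumes "P \<le> (SUP k \<in> K. prog_pow J R k)"
  shows "prog_star J P \<le> prog_star J R"
  unfolding prog_star_def[of J P]
proof (rule lfp_lowerbound, rule sup_least)
  have "prog_comp J P (prog_star J R) \<le> prog_comp J (SUP k \<in> K. prog_pow J R k) (prog_star J R)"
    by (rule prog_comp_mono[OF assms order_refl])
  also have "\<dots> \<le> (SUP k \<in> K. prog_comp J (prog_pow J R k) (prog_star J R))"
    by (rule prog_comp_Sup_left)
  also have "\<dots> \<le> prog_star J R"
    by (rule SUP_least) (rule prog_pow_comp_prog_star)
  finally show "prog_comp J P (prog_star J R) \<le> prog_star J R" .
qed (rule one_le_prog_star)

section \<open>Sizes of strings\<close>

lemma psize_comp:
  assumes "x \<in> fin_pstrings" "y \<in> fin_pstrings" "disjoint_pstrings x y"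
  shows "psize (J x y) = psize x + psize y"
  using assms
  by (simp add: psize_def comp_events card_Un_disjoint fin_pstrings_def disjoint_pstrings_def)

text \<open>Refinement preserves size and disjoint composition adds sizes, so each of the
  \<open>k\<close> factors contributes at least \<open>l\<close> events.\<close>

lemma psize_prog_pow_ge:
  assumes "\<And>y. y \<in> strings P \<Longrightarrow> l \<le> psize y" and "s \<in> strings (prog_pow J P k)"
  shows "k * l \<le> psize s"
  using assms(2)
proof (induction k arbitrary: s)
  case (Suc k)
  from Suc.prems obtain x y where "x \<in> strings P" "y \<in> strings (prog_pow J P k)"
    "disjoint_pstrings x y" "s \<sqsubseteq>\<^sub>p J x y"
    unfolding prog_pow.simps by (rule prog_comp_stringsE')
  moreover from this have "psize s = psize x + psize y"
    using psize_refines psize_comp strings_subset by (metis subsetD)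
  ultimately show ?case
    using assms(1)[of x] Suc.IH[of y] by simp
qed simp

end

text \<open>Ensures that \<open>Max\<close> and \<open>Min\<close> in the theorem are taken over
  finite nonempty sets: every string of the program has the size of one of its finitely many
  generators.\<close>

lemma elementary_finite_psize:
  assumes "elementary P"
  shows "finite (psize ` strings P)" and "strings P \<noteq> {}"
proof -
  obtain Q where Q: "finite Q" "Q \<noteq> {}" "Q \<subseteq> fin_pstrings" "strings P = down Q"
    using assms by (auto simp: elementary_def)
  have "psize ` strings P \<subseteq> psize ` Q"
    unfolding Q(4) down_def using psize_refines by fastforce
  then show "finite (psize ` strings P)"
    using Q(1) finite_subset by blast
  show "strings P \<noteq> {}"
    using Q(2,3) refines_refl unfolding Q(4) down_def by blast
qed

theorem theorem2:
  fixes J :: "('e, 'g) pstring \<Rightarrow> ('e, 'g) pstring \<Rightarrow> ('e, 'g) pstring"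
    and X Y :: "('e, 'g) program"
    and l\<^sub>X l\<^sub>Y n :: nat
  assumes "J \<in> {seq_comp, par_comp}"
    and "elementary X" and "elementary Y"
    and "empty_pstring \<notin> strings Y"
    and "l\<^sub>X = Max (psize ` strings X)"
    and "l\<^sub>Y = Min (psize ` strings Y)"
    and "n = l\<^sub>X div l\<^sub>Y"
  shows "prog_star J X \<le> prog_star J Y \<longleftrightarrow> X \<le> (SUP k \<in> {0..n}. prog_pow J Y k)"
proof
  note J = assms(1)
  assume star: "prog_star J X \<le> prog_star J Y"
  have l\<^sub>Y: "l\<^sub>Y \<le> psize y" if "y \<in> strings Y" for y
    using that elementary_finite_psize(1)[OF assms(3)] assms(6) by simp
  \<comment> \<open>The minimum is attained, so \<open>l\<^sub>Y\<close> is the size of an actual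
    string of \<open>Y\<close>, which cannot be the empty one.\<close>
  have "l\<^sub>Y \<in> psize ` strings Y"
    unfolding assms(6) using elementary_finite_psize[OF assms(3)] by (intro Min_in) auto
  then obtain y where y: "y \<in> strings Y" "l\<^sub>Y = psize y"
    by blast
  then have "y \<in> fin_pstrings" "y \<noteq> empty_pstring"
    using strings_subset assms(4) by blast+
  then have pos: "l\<^sub>Y > 0"
    using fin_pstring_no_events y(2) by (auto simp: psize_def fin_pstrings_def card_gt_0_iff)
  show "X \<le> (SUP k \<in> {0..n}. prog_pow J Y k)"
    unfolding less_eq_program.rep_eq
  proof
    fix x
    assume x: "x \<in> strings X"
    \<comment> \<open>\<open>X\<close> lies below its own star, hence below the star of
      \<open>Y\<close>, hence below the union of all powers; sizes then bound the index.\<close>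
    have "X \<le> (SUP k. prog_pow J Y k)"
      using le_prog_star[OF J] star prog_star_le_Sup_prog_pow[OF J] by (meson order_trans)
    with x obtain k where k: "x \<in> strings (prog_pow J Y k)"
      by (auto simp: less_eq_program.rep_eq Sup_program.rep_eq)
    have "k * l\<^sub>Y \<le> psize x"
      using psize_prog_pow_ge[OF J l\<^sub>Y k] .
    also have "psize x \<le> l\<^sub>X"
      using x elementary_finite_psize(1)[OF assms(2)] assms(5) by simp
    \<comment> \<open>As \<open>l\<^sub>Y\<close> is positive,
      \<open>k * l\<^sub>Y \<le> l\<^sub>X\<close> is exactly
      \<open>k \<le> l\<^sub>X div l\<^sub>Y\<close>.\<close>
    finally have "k \<le> n"
      using pos assms(7) by (simp add: less_eq_div_iff_mult_less_eq)
    with k show "x \<in> strings (SUP k \<in> {0..n}. prog_pow J Y k)"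
      by (auto simp: Sup_program.rep_eq)
  qed
next
  assume "X \<le> (SUP k \<in> {0..n}. prog_pow J Y k)"
  then show "prog_star J X \<le> prog_star J Y"
    by (rule prog_star_le_if_le_Sup_prog_pow[OF assms(1)])
qed

end
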